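(* Let $q=4$ and $n=1+2q^2+q^4+q^e+2q^{e+2}$, where $e$ is a positive integer. Then $$g_{n,q}\equiv X^{q^3}+S_e+S_2^2S_e^2+S_4S_e^3\pmod{X^{q^e}-X}.$$ If $2\mid e$ but $5\nmid e$, then $g_{n,q}$ is a permutation polynomial of $\mathbb F_{q^e}$.
   Context: For a prime power $q$ with $p=\operatorname{char}\mathbb F_q$ and an integer $n\ge 0$, $g_{n,q}\in\mathbb F_p[X]$ is the polynomial defined by the functional equation $\sum_{c\in\mathbb F_q}(X+c)^n=g_{n,q}(X^q-X)$. For each integer $a\ge 0$, $S_a=X+X^q+\cdots+X^{q^{a-1}}$ (with $S_0=0$). Products and powers of the $S_a$ are ordinary products and powers of polynomials. A polynomial over a finite field $F$ is a permutation polynomial of $F$ if it induces a bijection $F\to F$. *)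

theory Defs
  imports
    "HOL-Algebra.Algebraic_Closure_Type"
    "HOL-Library.Z2"
    "HOL-Number_Theory.Cong"
begin

abbreviation pX :: "'a::comm_semiring_1 poly" where
  "pX \<equiv> [:0, 1:]"

text \<open>
  The prime field \<open>\<bbbF>\<^sub>p\<close> is a field type \<open>'k\<close> (for \<open>p = 2\<close> it is \<^typ>\<open>bit\<close>). All its finite
  extensions are taken inside one algebraic closure: for a power \<open>q\<close> of \<open>p\<close>, the field with
  \<open>q\<close> elements is the set of roots of \<open>X\<^sup>q - X\<close> there. The lemmas below confirm that this is a
  subfield with exactly \<open>q\<close> elements.
\<close>

definition GF :: "nat \<Rightarrow> 'k::field alg_closure set" where
  "GF q = {c. c ^ q = c}"

text \<open>
  \<open>g_poly q n\<close> is \<open>g\<^sub>n\<^sub>,\<^sub>q\<close>, with coefficients in the prime field; the functional equation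
  is read in polynomials over the algebraic closure, and \<open>[:c, 1:]\<close> is \<open>X + c\<close>.
\<close>

definition g_poly :: "nat \<Rightarrow> nat \<Rightarrow> 'k::field poly" where
  "g_poly q n = (THE g. (\<Sum>c\<in>GF q. [:c, 1:] ^ n) = pcompose (map_poly to_ac g) (pX ^ q - pX))"

definition S :: "nat \<Rightarrow> nat \<Rightarrow> 'k::comm_semiring_1 poly" where
  "S q a = (\<Sum>i<a. pX ^ (q ^ i))"

definition permutation_polynomial :: "'a::comm_semiring_0 set \<Rightarrow> 'a poly \<Rightarrow> bool" where
  "permutation_polynomial F f \<longleftrightarrow> bij_betw (poly f) F F"

context
  fixes p q k :: nat
  assumes p: "Factorial_Ring.prime p" "CHAR('k::field) = p" and q: "q = p ^ k" "k > 0"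
begin

lemma GF_add: "x + y \<in> GF q" if "x \<in> GF q" "y \<in> GF q" for x y :: "'k alg_closure"
  using that p q by (simp add: GF_def freshmans_dream' [where n = k])

lemma GF_mult: "x * y \<in> GF q" if "x \<in> GF q" "y \<in> GF q" for x y :: "'k alg_closure"
  using that by (simp add: GF_def power_mult_distrib)

lemma GF_inverse: "inverse x \<in> GF q" if "x \<in> GF q" for x :: "'k alg_closure"
  using that by (simp add: GF_def power_inverse)

lemma GF_uminus: "- x \<in> GF q" if "x \<in> GF q" for x :: "'k alg_closure"
proof -
  have "x + - x = 0" by simp
  have "q > 0" using p(1) q by (simp add: prime_gt_0_nat)
  have "x ^ q + (- x) ^ q = (x + - x) ^ q"
    using p q by (intro freshmans_dream' [where n = k, symmetric]) simp_all
  also have "\<dots> = 0" using \<open>q > 0\<close> by (simp add: power_0_left)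
  finally show ?thesis
    using that by (simp add: GF_def eq_neg_iff_add_eq_0 add.commute)
qed

lemma card_GF: "card (GF q :: 'k alg_closure set) = q"
proof -
  let ?f = "pX ^ q - pX :: 'k alg_closure poly"
  have q1: "q > 1"
    using one_less_power [OF prime_gt_1_nat [OF p(1)] q(2)] q(1) by simp
  have degX: "degree (pX ^ q :: 'k alg_closure poly) = q"
    by (simp add: degree_power_eq)
  have deg: "degree ?f = q"
    using q1 degX degree_add_eq_left [of "- pX" "pX ^ q :: 'k alg_closure poly"]
    by (simp add: diff_conv_add_uminus del: add_uminus_conv_diff)
  then have nz: "?f \<noteq> 0"
    using q1 by auto
  have GF: "GF q = {x :: 'k alg_closure. poly ?f x = 0}"
    by (simp add: GF_def poly_power)
  have "p dvd q"
    using q by simp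
  then have "of_nat q = (0 :: 'k alg_closure)"
    using p by (simp add: of_nat_eq_0_iff_char_dvd)
  then have pderiv: "pderiv ?f = -1"
    by (simp add: pderiv_diff pderiv_power pderiv_pCons of_nat_poly one_pCons)
  have order: "order x ?f \<le> 1" for x
  proof (rule ccontr)
    assume "\<not> order x ?f \<le> 1"
    then have "[:-x, 1:] ^ 2 dvd ?f"
      using nz by (auto simp: order_divides)
    then obtain h where "?f = [:-x, 1:] * ([:-x, 1:] * h)"
      by (metis dvdE mult.assoc power2_eq_square)
    then have "poly (pderiv ?f) x = 0"
      by (simp only: pderiv_mult) (simp add: pderiv_pCons)
    then show False
      using pderiv by simp
  qed
  obtain A where A: "size A = degree ?f" "?f = smult (lead_coeff ?f) (\<Prod>x\<in>#A. [:-x, 1:])"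
    using alg_closed_imp_factorization [OF nz] by blast
  have "proots ?f = proots (\<Prod>x\<in>#A. [:-x, 1:])"
    using A(2) nz by (metis leading_coeff_0_iff proots_smult)
  also have "\<dots> = A"
  proof (induction A)
    case (add x A)
    have "(\<Prod>x\<in>#A. [:-x, 1:]) \<noteq> 0"
      by auto
    then have "proots ([:-x, 1:] * (\<Prod>x\<in>#A. [:-x, 1:])) = proots [:-x, 1:] + A"
      using add by (subst proots_mult) auto
    then show ?case
      by (simp del: mult_pCons_left)
  qed simp
  finally have "size (proots ?f) = q"
    using A(1) deg by simp
  moreover have "size (proots ?f) = card {x. poly ?f x = 0}"
  proof -
    have "count (proots ?f) x = 1" if "x \<in># proots ?f" for x
    proof -
      have "count (proots ?f) x > 0" "count (proots ?f) x \<le> 1"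
        using that order [of x] unfolding count_proots [OF nz, symmetric]
        by (simp_all only: count_greater_zero_iff)
      then show ?thesis by linarith
    qed
    then have "size (proots ?f) = card (set_mset (proots ?f))"
      unfolding size_multiset_overloaded_eq card_eq_sum by (rule sum.cong [OF refl])
    then show ?thesis
      by (simp only: set_count_proots [OF nz])
  qed
  ultimately show ?thesis
    using GF by simp
qed

end

lemma CHAR_bit: "CHAR(bit) = 2"
proof (rule CHAR_eqI)
  show "of_nat 2 = (0 :: bit)" by simp
next
  fix m assume "of_nat m = (0 :: bit)"
  then have "even (of_nat m :: bit)" by (simp only: even_zero)
  then show "2 dvd m" by (simp only: even_of_nat)
qed

lemma card_GF_4: "card (GF (4 ^ e) :: bit alg_closure set) = 4 ^ e" if "e > 0"
  by (rule card_GF [of 2 _ "2 * e"]) (use that in \<open>simp_all add: CHAR_bit power_mult\<close>)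

end

theory Submission
  imports Defs
begin

text \<open>
  Write \<open>y = X\<^sup>4 - X\<close> and \<open>u = X + c\<close> with \<open>c \<in> \<bbbF>\<^sub>4\<close>. Then \<open>u\<^sup>4 - u = y\<close>, and the sum
  \<open>S\<^sub>a(y)\<close> telescopes, so \<open>u\<close> to the power \<open>4\<^sup>a\<close> is \<open>u + S\<^sub>a(y)\<close>. The base-4 digits of \<open>n\<close> thus
  turn \<open>u\<^sup>n\<close> into
  \<open>u (u + S\<^sub>2)\<^sup>2 (u + S\<^sub>4) (u + S\<^sub>e) (u + S\<^bsub>e+2\<^esub>)\<^sup>2\<close>, evaluated at \<open>y\<close>: a polynomial of degree 7 in
  \<open>u\<close> whose coefficients do not depend on \<open>c\<close>. The relation \<open>u\<^sup>4 = u + y\<close> lowers its degree to 3,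
  and summation over \<open>c\<close> extracts the coefficient of \<open>u\<^sup>3\<close>, because the power sums of the four
  elements of \<open>\<bbbF>\<^sub>4\<close> vanish for the exponents 0, 1, 2 and equal 1 for the exponent 3. This gives
  the closed form of \<open>g\<close> in \<open>g_poly_explicit\<close>. Modulo \<open>X\<^bsup>4^e\<^esup> - X\<close> one may replace \<open>S\<^bsub>e+2\<^esub>\<close> by
  \<open>S\<^sub>e + S\<^sub>2\<close>, and \<open>X + S\<^sub>4 + S\<^sub>2\<^sup>4\<close> collapses to \<open>X\<^sup>6\<^sup>4\<close>; this is the congruence \<open>g_poly_cong\<close>.

  For the permutation property, \<open>S\<^sub>e\<close> acts on \<open>\<bbbF>\<^bsub>4^e\<^esub>\<close> as the trace to \<open>\<bbbF>\<^sub>4\<close>. If \<open>e\<close> is even, the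
  trace of \<open>g(x)\<close> is the trace \<open>t\<close> of \<open>x\<close> (\<open>poly_S_reduced_map\<close>), so \<open>g(x)\<close> determines \<open>t\<close>. For
  fixed \<open>t\<close> the map is additive up to a constant, and it remains to see that its linear part has
  no kernel. For \<open>t = 0\<close> the linear part is \<open>d\<^sup>6\<^sup>4\<close>. For \<open>t \<noteq> 0\<close> the substitution \<open>d = t w\<close>, with \<open>t\<^sup>3 = 1\<close>,
  turns it into \<open>t (w + w\<^sup>2 + w\<^sup>4 + w\<^sup>8 + w\<^sup>1\<^sup>6)\<close>. Since \<open>1 + T + T\<^sup>2 + T\<^sup>3 + T\<^sup>4\<close> divides \<open>T\<^sup>5 - 1\<close>, a
  zero \<open>w\<close> is fixed by the fifth power of the Frobenius map \<open>w \<mapsto> w\<^sup>2\<close>, as well as by its power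
  \<open>2e\<close>. If 5 does not divide \<open>e\<close>, then \<open>w \<in> \<bbbF>\<^sub>2\<close>, where the value at 1 is 5, that is, 1; hence
  \<open>w = 0\<close> (\<open>linearized_quintic_root_eq_0\<close>).
\<close>

section \<open>Extension of scalars and composition\<close>

lemma map_poly_to_ac_add:
  "map_poly to_ac (f + g) = map_poly to_ac f + map_poly to_ac (g :: 'k::field poly)"
  by (rule poly_eqI) (simp add: coeff_map_poly)

lemma map_poly_to_ac_diff:
  "map_poly to_ac (f - g) = map_poly to_ac f - map_poly to_ac (g :: 'k::field poly)"
  by (rule poly_eqI) (simp add: coeff_map_poly)

lemma map_poly_to_ac_mult:
  "map_poly to_ac (f * g) = map_poly to_ac f * map_poly to_ac (g :: 'k::field poly)"
  by (rule poly_eqI) (simp add: coeff_map_poly coeff_mult to_ac_sum)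

lemma map_poly_to_ac_power:
  "map_poly to_ac (f ^ m) = map_poly to_ac (f :: 'k::field poly) ^ m"
  by (induction m) (simp_all add: map_poly_to_ac_mult)

lemma map_poly_to_ac_sum:
  "map_poly to_ac (\<Sum>i\<in>A. f i) = (\<Sum>i\<in>A. map_poly to_ac (f i :: 'k::field poly))"
  by (induction A rule: infinite_finite_induct) (simp_all add: map_poly_to_ac_add)

lemma map_poly_to_ac_pX: "map_poly to_ac (pX :: 'k::field poly) = pX"
  by (simp add: map_poly_pCons)

lemma map_poly_to_ac_S: "map_poly to_ac (S q a :: 'k::field poly) = S q a"
  by (simp add: S_def map_poly_to_ac_sum map_poly_to_ac_power map_poly_to_ac_pX)

lemmas map_poly_to_ac_simps =
  map_poly_to_ac_add map_poly_to_ac_diff map_poly_to_ac_mult map_poly_to_ac_power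
  map_poly_to_ac_pX map_poly_to_ac_S

lemma inj_map_poly_to_ac: "inj (map_poly to_ac :: 'k::field poly \<Rightarrow> _)"
proof (rule injI, rule poly_eqI)
  fix f g :: "'k poly" and i
  assume "map_poly to_ac f = map_poly to_ac g"
  then have "coeff (map_poly to_ac f) i = coeff (map_poly to_ac g) i"
    by simp
  then show "coeff f i = coeff g i"
    by (simp add: coeff_map_poly)
qed

lemma pcompose_power: "pcompose (f ^ m) g = pcompose f g ^ m"
  for f g :: "'a::comm_semiring_1 poly"
  by (induction m) (simp_all add: pcompose_mult pcompose_1)

lemma pcompose_pX: "pcompose pX g = g"
  for g :: "'a::comm_semiring_1 poly"
  by (simp add: pcompose_pCons)

lemma pcompose_S: "pcompose (S q a) g = (\<Sum>i<a. g ^ (q ^ i))"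
  for g :: "'a::comm_semiring_1 poly"
  by (simp add: S_def pcompose_sum pcompose_power pcompose_pX)

lemma poly_S: "poly (S q a) x = (\<Sum>i<a. x ^ (q ^ i))"
  for x :: "'a::comm_semiring_1"
  by (simp add: S_def poly_sum poly_power)

text \<open>
  The functional equation has at most one solution, since composition with the non-constant
  \<open>X\<^sup>q - X\<close> and extension of scalars are both injective. Exhibiting a solution therefore settles
  the definite description in the definition of \<open>g\<close>.
\<close>
lemma g_poly_eqI:
  fixes g :: "'k::field poly"
  assumes "q > 1"
    and eq: "(\<Sum>c\<in>GF q. [:c, 1:] ^ n) = pcompose (map_poly to_ac g) (pX ^ q - pX)"
  shows "g_poly q n = g"
  unfolding g_poly_def
proof (rule the_equality)
  let ?y = "pX ^ q - pX :: 'k alg_closure poly"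
  have "degree (pX ^ q :: 'k alg_closure poly) = q"
    by (simp add: degree_power_eq)
  then have deg: "degree ?y = q"
    using assms degree_add_eq_left [of "- pX" "pX ^ q :: 'k alg_closure poly"]
    by (simp add: diff_conv_add_uminus del: add_uminus_conv_diff)
  fix h :: "'k poly"
  assume "(\<Sum>c\<in>GF q. [:c, 1:] ^ n) = pcompose (map_poly to_ac h) ?y"
  then have "pcompose (map_poly to_ac h - map_poly to_ac g) ?y = 0"
    by (simp add: eq pcompose_diff)
  then have "map_poly to_ac h - map_poly to_ac g = 0"
    by (rule pcompose_eq_0) (simp only: deg \<open>q > 1\<close> order.strict_trans [OF zero_less_one])
  then show "h = g"
    by (simp add: inj_eq [OF inj_map_poly_to_ac])
qed (fact eq)

section \<open>Arithmetic in characteristic two\<close>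

text \<open>
  Taking \<open>q\<^sup>i\<close>-th powers is additive, so each summand is a difference of consecutive Frobenius
  iterates of \<open>x\<close>. Read from right to left, this is \<open>S\<^sub>a(x\<^sup>q - x)\<close>.
\<close>
lemma sum_power_Frobenius_telescope:
  fixes x :: "'a::comm_ring_1"
  assumes "Factorial_Ring.prime p" "CHAR('a) = p" "q = p ^ k"
  shows "(\<Sum>i<a. (x ^ q - x) ^ (q ^ i)) = x ^ (q ^ a) - x"
proof -
  have "(x ^ q - x) ^ (q ^ i) = x ^ (q ^ Suc i) - x ^ (q ^ i)" for i
  proof -
    have "((x ^ q - x) + x) ^ (q ^ i) = (x ^ q - x) ^ (q ^ i) + x ^ (q ^ i)"
      using assms by (intro freshmans_dream' [where n = "k * i"]) (simp_all add: power_mult)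
    then show ?thesis
      by (simp add: power_mult)
  qed
  then show ?thesis
    using sum_lessThan_telescope [of "\<lambda>i. x ^ (q ^ i)" a] by simp
qed

text \<open>
  Together with distributivity and AC-rewriting, these rules normalise polynomial expressions to
  sums of distinct monomials, which decides identities modulo 2.
\<close>
lemma char_2_simps:
  fixes x y :: "'a::comm_ring_1"
  assumes "CHAR('a) = 2"
  shows "x + x = 0" "x + (x + y) = y" "- x = x" "x - y = x + y"
    "numeral (num.Bit0 m) = (0 :: 'a)" "numeral (num.Bit1 m) = (1 :: 'a)"
proof -
  have "(2 :: 'a) = 0"
    using of_nat_CHAR [where ?'a = 'a] assms by simp
  then show self: "x + x = 0" for x :: 'a
    by (metis mult_2 mult_zero_left)
  then show "x + (x + y) = y"
    by (simp flip: add.assoc)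
  show minus: "- x = x" for x :: 'a
    using self [of x] by (simp add: minus_unique)
  then show "x - y = x + y"
    by (metis diff_conv_add_uminus)
  show "numeral (num.Bit0 m) = (0 :: 'a)" "numeral (num.Bit1 m) = (1 :: 'a)"
    by (simp_all add: numeral.simps self)
qed

lemmas expand_char_2 = algebra_simps eval_nat_numeral char_2_simps CHAR_bit

lemma power_add_char_2: "(x + y) ^ (2 ^ m) = x ^ (2 ^ m) + y ^ (2 ^ m)"
  for x y :: "bit alg_closure"
  by (rule freshmans_dream' [where n = m]) (simp_all add: CHAR_bit)

section \<open>Summation over the field with four elements\<close>

lemma GF_4_enumeration:
  obtains \<omega> :: "bit alg_closure"
  where "\<omega>\<^sup>2 = \<omega> + 1" "GF 4 = {0, 1, \<omega>, \<omega> + 1}" "card {0, 1, \<omega>, \<omega> + 1} = 4"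
proof -
  have card: "card (GF 4 :: bit alg_closure set) = 4"
    using card_GF_4 [of 1] by simp
  have "\<not> GF 4 \<subseteq> {0, 1 :: bit alg_closure}"
    using card_mono [of "{0, 1 :: bit alg_closure}" "GF 4"] card by auto
  then obtain \<omega> :: "bit alg_closure" where w: "\<omega> \<in> GF 4" "\<omega> \<noteq> 0" "\<omega> \<noteq> 1"
    by auto
  have "\<omega> * (\<omega> - 1) * (\<omega>\<^sup>2 + \<omega> + 1) = \<omega> ^ 4 - \<omega>"
    by (simp add: algebra_simps eval_nat_numeral)
  then have "\<omega>\<^sup>2 + \<omega> + 1 = 0"
    using w by (simp add: GF_def)
  moreover have "\<omega>\<^sup>2 = (\<omega>\<^sup>2 + \<omega> + 1) + (\<omega> + 1)"
    by (simp add: expand_char_2)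
  ultimately have w2: "\<omega>\<^sup>2 = \<omega> + 1"
    by simp
  have "\<omega> + 1 \<noteq> 0"
    using w by (metis CHAR_bit CHAR_alg_closure add_right_cancel char_2_simps(1))
  then have c4: "card {0, 1, \<omega>, \<omega> + 1} = 4"
    using w by auto
  have "(\<omega> + 1) ^ 4 = \<omega> + 1"
    using w power_add_char_2 [of \<omega> 1 2] by (simp add: GF_def)
  then have "{0, 1, \<omega>, \<omega> + 1} \<subseteq> GF 4"
    using w by (auto simp: GF_def)
  moreover have "finite (GF 4 :: bit alg_closure set)"
    by (rule card_ge_0_finite) (simp add: card)
  ultimately have "GF 4 = {0, 1, \<omega>, \<omega> + 1}"
    using card c4 by (metis card_subset_eq)
  with w2 c4 show ?thesis
    using that by blast
qed

text \<open>
  The sums of \<open>(X + c)\<^sup>k\<close> over \<open>c \<in> \<bbbF>\<^sub>4\<close> are 0 for \<open>k = 0, 1, 2\<close> and 1 for \<open>k = 3\<close>, so summation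
  reads off a leading coefficient.
\<close>
lemma sum_GF_4_cubic:
  fixes c\<^sub>0 c\<^sub>1 c\<^sub>2 c\<^sub>3 :: "bit alg_closure poly"
  shows "(\<Sum>c\<in>GF 4. c\<^sub>0 + c\<^sub>1 * [:c, 1:] + c\<^sub>2 * [:c, 1:] ^ 2 + c\<^sub>3 * [:c, 1:] ^ 3) = c\<^sub>3"
proof -
  obtain \<omega> :: "bit alg_closure" where w: "\<omega>\<^sup>2 = \<omega> + 1"
      and GF: "GF 4 = {0, 1, \<omega>, \<omega> + 1}" and card: "card {0, 1, \<omega>, \<omega> + 1} = 4"
    by (rule GF_4_enumeration)
  \<comment> \<open>Opaque names for \<open>X\<close> and the constant \<open>\<omega>\<close> keep the simplifier from computing with coefficient
    lists, so that the sum is a ring identity modulo \<open>W\<^sup>2 = W + 1\<close>.\<close>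
  define W where "W = [:\<omega>:]"
  have W: "W\<^sup>2 = W + 1"
    using w by (simp add: W_def poly_const_pow one_pCons)
  define z :: "bit alg_closure poly" where "z = pX"
  have linear: "[:0, 1:] = z" "[:1, 1:] = z + 1" "[:\<omega>, 1:] = z + W" "[:\<omega> + 1, 1:] = z + W + 1"
    by (simp_all add: z_def W_def one_pCons)
  have distinct: "0 \<notin> {1, \<omega>, \<omega> + 1}" "1 \<notin> {\<omega>, \<omega> + 1}" "\<omega> \<notin> {\<omega> + 1}"
    using card by (auto simp: card_insert_if split: if_splits)
  define f where "f u = c\<^sub>0 + c\<^sub>1 * u + c\<^sub>2 * u ^ 2 + c\<^sub>3 * u ^ 3" for u
  have "(\<Sum>c\<in>GF 4. f [:c, 1:]) = f z + (f (z + 1) + (f (z + W) + f (z + W + 1)))"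
    unfolding GF using distinct
    by (simp only: sum.insert finite.intros sum.empty add_0_right linear not_False_eq_True empty_iff)
  also have "\<dots> = c\<^sub>3"
  proof -
    have "W * W = W + 1" "W * (W * f) = W * f + f" for f
      using W by (simp_all add: power2_eq_square distrib_right flip: mult.assoc)
    then show ?thesis
      by (simp add: f_def expand_char_2)
  qed
  finally show ?thesis
    unfolding f_def .
qed

text \<open>
  The polynomial \<open>X\<^sup>4 - X\<close> is invariant under \<open>X \<mapsto> X + c\<close>, so the telescoping sum for \<open>X + c\<close>
  has the same value for every \<open>c \<in> \<bbbF>\<^sub>4\<close>.
\<close>
lemma power_linear_GF_4:
  fixes c :: "bit alg_closure"
  assumes "c \<in> GF 4"
  shows "[:c, 1:] ^ (4 ^ a) = [:c, 1:] + pcompose (S 4 a) (pX ^ 4 - pX)"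
proof -
  have "[:c, 1:] ^ 4 = ([:c:] + pX) ^ 4"
    by simp
  also have "\<dots> = [:c:] ^ 4 + pX ^ 4"
    by (rule freshmans_dream' [where n = 2]) (simp_all add: CHAR_bit)
  finally have "[:c, 1:] ^ 4 - [:c, 1:] = pX ^ 4 - pX"
    using assms by (simp add: GF_def poly_const_pow)
  then show ?thesis
    using sum_power_Frobenius_telescope [of 2 4 2 "[:c, 1:]" a]
    by (simp add: pcompose_S CHAR_bit)
qed

section \<open>The polynomial and its reduction\<close>

text \<open>
  An identity of polynomials, before any reduction modulo \<open>X\<^bsup>4^e\<^esup> - X\<close>: it is the coefficient of
  \<open>u\<^sup>3\<close> in \<open>u\<^sup>n\<close> after reduction by \<open>u\<^sup>4 = u + y\<close>, with \<open>y\<close> renamed to \<open>X\<close>.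
\<close>
lemma g_poly_explicit:
  assumes "n = 1 + 2 * 4 ^ 2 + 4 ^ 4 + 4 ^ e + 2 * 4 ^ (e + 2)"
  shows "g_poly 4 n = pX + S 4 4 + S 4 e + S 4 2 ^ 2 * S 4 (e + 2) ^ 2
           + (S 4 2 ^ 2 + S 4 (e + 2) ^ 2) * S 4 4 * (S 4 e :: bit poly)"
proof (rule g_poly_eqI)
  define y :: "bit alg_closure poly" where "y = pX ^ 4 - pX"
  define A where "A = pcompose (S 4 2) y ^ 2"
  define B where "B = pcompose (S 4 4) y"
  define D where "D = pcompose (S 4 (e + 2)) y ^ 2"
  define E where "E = pcompose (S 4 e) y"
  have "[:c, 1:] ^ n
      = ((B + E) * (A + D) * y + y)
        + (1 + (B * E + A + D) * y + (B + E) * (A + D) + B * E * A * D) * [:c, 1:]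
        + ((B + E) * y + (B * E + A + D) + (B + E) * A * D) * [:c, 1:] ^ 2
        + (y + B + E + A * D + (A + D) * B * E) * [:c, 1:] ^ 3"
    if c: "c \<in> GF 4" for c
  proof -
    define u where "u = [:c, 1:]"
    have pow: "u ^ (4 ^ a) = u + pcompose (S 4 a) y" for a
      using power_linear_GF_4 [OF c] by (simp add: u_def y_def)
    have pow2: "(u ^ (4 ^ a)) ^ 2 = u ^ 2 + pcompose (S 4 a) y ^ 2" for a
      unfolding pow by (simp add: expand_char_2)
    have u4: "u ^ 4 = u + y"
      using pow [of 1] by (simp add: pcompose_S)
    \<comment> \<open>A cubic in \<open>u\<close> is needed to apply the summation lemma; of the powers above the third,
      only \<open>u\<^sup>6\<close> and \<open>u\<^sup>7\<close> contribute to the coefficient of \<open>u\<^sup>3\<close>.\<close>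
    have u5: "u ^ 5 = u ^ 2 + y * u" and u6: "u ^ 6 = u ^ 3 + y * u ^ 2"
      and u7: "u ^ 7 = u + y + y * u ^ 3"
      using u4 power_add [of u 4 1] power_add [of u 4 2] power_add [of u 4 3]
      by (simp_all add: algebra_simps eval_nat_numeral)
    have "u ^ n = u * (u ^ (4 ^ 2)) ^ 2 * u ^ (4 ^ 4) * u ^ (4 ^ e) * (u ^ (4 ^ (e + 2))) ^ 2"
      unfolding assms power_add [of u] power_mult [symmetric] by (simp add: mult.commute)
    also have "\<dots> = u * (u ^ 2 + A) * (u + B) * (u + E) * (u ^ 2 + D)"
      by (simp only: pow2) (simp only: pow A_def B_def D_def E_def)
    also have "\<dots> = u ^ 7 + (B + E) * u ^ 6 + (B * E + A + D) * u ^ 5 + (B + E) * (A + D) * u ^ 4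
        + (A * D + (A + D) * B * E) * u ^ 3 + (B + E) * A * D * u ^ 2 + B * E * A * D * u"
      by (simp add: algebra_simps eval_nat_numeral)
    also have "\<dots> = ((B + E) * (A + D) * y + y)
        + (1 + (B * E + A + D) * y + (B + E) * (A + D) + B * E * A * D) * u
        + ((B + E) * y + (B * E + A + D) + (B + E) * A * D) * u ^ 2
        + (y + B + E + A * D + (A + D) * B * E) * u ^ 3"
      by (simp only: u4 u5 u6 u7) (simp add: algebra_simps)
    finally show ?thesis
      by (simp only: u_def)
  qed
  then have "(\<Sum>c\<in>GF 4. [:c, 1:] ^ n) = y + B + E + A * D + (A + D) * B * E"
    by (simp only: sum_GF_4_cubic cong: sum.cong)
  then show "(\<Sum>c\<in>GF 4. [:c, 1:] ^ n) =
      pcompose (map_poly to_ac (pX + S 4 4 + S 4 e + S 4 2 ^ 2 * S 4 (e + 2) ^ 2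
           + (S 4 2 ^ 2 + S 4 (e + 2) ^ 2) * S 4 4 * (S 4 e :: bit poly))) (pX ^ 4 - pX)"
    by (simp only: map_poly_to_ac_simps pcompose_add pcompose_mult pcompose_power pcompose_pX
        A_def B_def D_def E_def flip: y_def)
qed simp

lemma cong_S_add_2:
  "[S q (e + 2) = S q e + S q 2] (mod (pX ^ (q ^ e) - pX :: 'a::field poly))"
proof -
  let ?m = "pX ^ (q ^ e) - pX :: 'a poly"
  have X: "[pX ^ (q ^ e) = pX] (mod ?m)"
    by (simp add: cong_iff_dvd_diff)
  have "S q (e + 2) = S q e + (pX ^ (q ^ e) + (pX ^ (q ^ e)) ^ q :: 'a poly)"
    by (simp add: S_def power_mult [symmetric] mult.commute add.assoc)
  moreover have "S q 2 = pX + (pX ^ q :: 'a poly)"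
    by (simp add: S_def eval_nat_numeral)
  ultimately show ?thesis
    using cong_add [OF cong_refl cong_add [OF X cong_pow [OF X, of q]], of "S q e"] by simp
qed

lemma g_poly_cong:
  assumes "n = 1 + 2 * 4 ^ 2 + 4 ^ 4 + 4 ^ e + 2 * 4 ^ (e + 2)"
  shows "[g_poly 4 n = pX ^ (4 ^ 3) + S 4 e + S 4 2 ^ 2 * S 4 e ^ 2 + S 4 4 * S 4 e ^ 3]
           (mod (pX ^ (4 ^ e) - pX :: bit poly))"
proof -
  \<comment> \<open>The argument \<open>s\<close> marks the place of \<open>S\<^bsub>e+2\<^esub>\<close>, the only part that the modulus changes.\<close>
  define f :: "bit poly \<Rightarrow> bit poly"
    where "f s = pX + S 4 4 + S 4 e + S 4 2 ^ 2 * s ^ 2 + (S 4 2 ^ 2 + s ^ 2) * S 4 4 * S 4 e" for s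
  have X: "pX + S 4 4 + S 4 2 ^ 4 = (pX ^ (4 ^ 3) :: bit poly)"
  proof -
    have "S 4 4 = pX + pX ^ 4 + pX ^ 16 + (pX ^ 64 :: bit poly)"
         "S 4 2 = pX + (pX ^ 4 :: bit poly)"
      by (simp_all add: S_def eval_nat_numeral)
    moreover have "(pX + pX ^ 4) ^ 4 = pX ^ 4 + (pX ^ 16 :: bit poly)"
      using freshmans_dream' [of 4 2 pX "pX ^ 4 :: bit poly"]
      by (simp add: CHAR_bit flip: power_mult)
    ultimately show ?thesis
      by (simp add: char_2_simps CHAR_bit ac_simps)
  qed
  have "[f (S 4 (e + 2)) = f (S 4 e + S 4 2)] (mod (pX ^ (4 ^ e) - pX))"
    unfolding f_def
    by (intro cong_add cong_mult cong_pow cong_refl cong_S_add_2 [where q = 4])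
  moreover have "f (S 4 e + S 4 2)
      = (pX + S 4 4 + S 4 2 ^ 4) + S 4 e + S 4 2 ^ 2 * S 4 e ^ 2 + S 4 4 * S 4 e ^ 3"
  proof -
    have "x + B + E + A ^ 2 * (E + A) ^ 2 + (A ^ 2 + (E + A) ^ 2) * B * E
        = (x + B + A ^ 4) + E + A ^ 2 * E ^ 2 + B * E ^ 3" for x A B E :: "bit poly"
      by (simp add: expand_char_2)
    then show ?thesis
      by (simp only: f_def)
  qed
  ultimately show ?thesis
    by (simp only: g_poly_explicit [OF assms] f_def X)
qed

section \<open>Finite subfields and the trace\<close>

lemma GF_power: "x ^ m \<in> GF q" if "x \<in> GF q"
proof -
  have "(x ^ m) ^ q = (x ^ q) ^ m"
    by (simp only: mult.commute flip: power_mult)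
  then show ?thesis
    using that by (simp add: GF_def)
qed

lemma GF_power_subset: "x \<in> GF (q ^ m)" if "x \<in> GF q"
  by (induction m) (use that in \<open>simp_all add: GF_def power_mult\<close>)

text \<open>
  The elements fixed by two powers of the Frobenius map are fixed by the power whose exponent is
  the greatest common divisor, by Bezout's identity.
\<close>
lemma GF_gcd:
  assumes "x \<in> GF (q ^ a)" "x \<in> GF (q ^ b)"
  shows "x \<in> GF (q ^ gcd a b)"
proof (cases "a = 0")
  case True
  then show ?thesis
    using assms by simp
next
  case False
  then obtain i j where ij: "a * i = b * j + gcd a b"
    using bezout_nat by blast
  have iter: "x ^ (q ^ (k * m)) = x" if "x \<in> GF (q ^ k)" for k m
    using GF_power_subset [OF that, of m] by (simp add: GF_def power_mult)
  have "x = x ^ (q ^ (b * j + gcd a b))"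
    using iter [OF assms(1), of i] ij by simp
  also have "\<dots> = (x ^ (q ^ (b * j))) ^ (q ^ gcd a b)"
    by (simp add: power_add power_mult)
  also have "\<dots> = x ^ (q ^ gcd a b)"
    by (simp add: iter [OF assms(2)])
  finally show ?thesis
    by (simp add: GF_def)
qed

text \<open>
  On \<open>\<bbbF>\<^bsub>4^e\<^esub>\<close>, \<open>S\<^sub>e\<close> is the trace to \<open>\<bbbF>\<^sub>4\<close>: the Frobenius map permutes its summands cyclically. The
  lemmas after this one give its additivity, its compatibility with squaring, and its linearity
  over the subfield; these hold on the whole algebraic closure.
\<close>
lemma poly_S_in_GF_4:
  fixes x :: "bit alg_closure"
  assumes "x \<in> GF (4 ^ e)"
  shows "poly (S 4 e) x \<in> GF 4"
proof -
  have "poly (S 4 e) x ^ 4 = (\<Sum>i<e. (x ^ (4 ^ i)) ^ 4)"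
    unfolding poly_S by (rule freshmans_dream_sum' [where n = 2]) (simp_all add: CHAR_bit)
  also have "\<dots> = (\<Sum>i<e. x ^ (4 ^ Suc i))"
    by (simp add: mult.commute flip: power_mult)
  also have "\<dots> = poly (S 4 e) x"
    using assms sum_lessThan_telescope [of "\<lambda>i. x ^ (4 ^ i)" e]
    by (simp add: poly_S GF_def sum_subtractf)
  finally show ?thesis
    by (simp add: GF_def)
qed

lemma poly_S_add: "poly (S 4 e) (x + y) = poly (S 4 e) x + poly (S 4 e) y"
  for x y :: "bit alg_closure"
  using power_add_char_2 [of x y "2 * i" for i]
  by (simp add: poly_S sum.distrib power_mult)

lemma poly_S_power: "poly (S 4 e) (x ^ (2 ^ m)) = poly (S 4 e) x ^ (2 ^ m)"
  for x :: "bit alg_closure"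
  unfolding poly_S
  by (subst freshmans_dream_sum' [where n = m]) (simp_all add: CHAR_bit mult.commute flip: power_mult)

lemma poly_S_mult:
  fixes c x :: "'k::field alg_closure"
  assumes "c \<in> GF q"
  shows "poly (S q e) (c * x) = c * poly (S q e) x"
  using GF_power_subset [OF assms]
  by (simp add: poly_S GF_def power_mult_distrib sum_distrib_left)

section \<open>The permutation property\<close>

text \<open>
  The function that the reduced form of \<open>g\<close> induces, with \<open>S\<^sub>2\<close> and \<open>S\<^sub>4\<close> written out and the
  trace of \<open>x\<close> left as it is.
\<close>
definition reduced_map :: "nat \<Rightarrow> bit alg_closure \<Rightarrow> bit alg_closure"
  where "reduced_map e x = x ^ 64 + poly (S 4 e) x + (x + x ^ 4) ^ 2 * poly (S 4 e) x ^ 2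
    + (x + x ^ 4 + x ^ 16 + x ^ 64) * poly (S 4 e) x ^ 3"

text \<open>
  Frobenius conjugates have conjugate traces, and here the trace \<open>t\<close> lies in \<open>\<bbbF>\<^sub>4\<close>. Hence \<open>S\<^sub>2(x)\<^sup>2\<close>
  and \<open>S\<^sub>4(x)\<close>, which have an even number of summands, have trace 0, and only the first
  two terms \<open>x\<^sup>6\<^sup>4\<close> and \<open>t\<close> remain. The trace of \<open>t\<close> itself is \<open>e t\<close>, which is why \<open>e\<close> is taken
  to be even.
\<close>
lemma poly_S_reduced_map:
  assumes "x \<in> GF (4 ^ e)" "even e"
  shows "poly (S 4 e) (reduced_map e x) = poly (S 4 e) x"
proof -
  define t where "t = poly (S 4 e) x"
  have t: "t \<in> GF 4"
    using poly_S_in_GF_4 [OF assms(1)] by (simp add: t_def)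
  have t_pow: "t ^ 4 = t" "t ^ 16 = t" "t ^ 64 = t"
    using GF_power_subset [OF t, of 1] GF_power_subset [OF t, of 2] GF_power_subset [OF t, of 3]
    by (simp_all add: GF_def)
  have t2: "t ^ 2 \<in> GF 4" and t3: "t ^ 3 \<in> GF 4"
    using t by (rule GF_power)+
  have const: "poly (S 4 e) t = 0"
  proof -
    have "poly (S 4 e) 1 = (0 :: bit alg_closure)"
      using assms(2) by (auto simp: poly_S char_2_simps CHAR_bit elim!: evenE)
    then show ?thesis
      using poly_S_mult [OF t, of e 1] by simp
  qed
  have pow: "poly (S 4 e) (x ^ 4) = t" "poly (S 4 e) (x ^ 16) = t" "poly (S 4 e) (x ^ 64) = t"
    using poly_S_power [of e x 2] poly_S_power [of e x 4] poly_S_power [of e x 6]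
    by (simp_all add: t_pow flip: t_def)
  have sq: "poly (S 4 e) ((x + x ^ 4) ^ 2) = 0"
    using poly_S_power [of e "x + x ^ 4" 1]
    by (simp add: poly_S_add pow char_2_simps CHAR_bit flip: t_def)
  have "poly (S 4 e) (reduced_map e x)
      = t + poly (S 4 e) t + t ^ 2 * poly (S 4 e) ((x + x ^ 4) ^ 2) + t ^ 3 * (t + t + t + t)"
    unfolding reduced_map_def t_def [symmetric]
    by (simp only: poly_S_add pow poly_S_mult [OF t2] poly_S_mult [OF t3]
        mult.commute [of _ "t ^ 2"] mult.commute [of _ "t ^ 3"] flip: t_def)
  then show ?thesis
    by (simp add: const sq char_2_simps CHAR_bit add.assoc flip: t_def)
qed

text \<open>
  Under the correspondence of \<open>w\<close> to the power \<open>2\<^sup>i\<close> with \<open>T\<^sup>i\<close>, the hypothesis on \<open>w\<close> is the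
  cyclotomic polynomial \<open>1 + T + T\<^sup>2 + T\<^sup>3 + T\<^sup>4\<close>. Multiplication by \<open>T + 1\<close>, that is, adding the
  square, gives \<open>T\<^sup>5 + 1\<close>, so \<open>w\<close> lies in \<open>\<bbbF>\<^sub>3\<^sub>2\<close>. Its intersection with \<open>\<bbbF>\<^bsub>4^e\<^esub>\<close> is \<open>\<bbbF>\<^sub>2\<close>,
  because 5 is coprime to \<open>2e\<close>.
\<close>
lemma linearized_quintic_root_eq_0:
  fixes w :: "bit alg_closure"
  assumes "w \<in> GF (4 ^ e)" "\<not> 5 dvd e" "w + w ^ 2 + w ^ 4 + w ^ 8 + w ^ 16 = 0"
  shows "w = 0"
proof -
  have "(w + w ^ 2 + w ^ 4 + w ^ 8 + w ^ 16) ^ 2 = w ^ 2 + w ^ 4 + w ^ 8 + w ^ 16 + w ^ 32"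
    by (simp add: power_add_char_2 [where m = 1, simplified] flip: power_mult)
  then have "w ^ 32 = w + (w + w ^ 2 + w ^ 4 + w ^ 8 + w ^ 16)
      + (w + w ^ 2 + w ^ 4 + w ^ 8 + w ^ 16) ^ 2"
    by (simp add: char_2_simps CHAR_bit ac_simps)
  then have "w ^ 32 = w"
    by (simp add: assms(3))
  then have "w \<in> GF (2 ^ 5)"
    by (simp add: GF_def)
  moreover have "w \<in> GF (2 ^ (2 * e))"
    using assms(1) by (simp add: power_mult)
  ultimately have "w \<in> GF (2 ^ gcd 5 (2 * e))"
    by (rule GF_gcd)
  moreover have "gcd 5 (2 * e) = 1"
  proof -
    have "Factorial_Ring.prime (5 :: nat)"
      by simp
    moreover from this have "\<not> 5 dvd 2 * e"
      using assms(2) by (simp add: prime_dvd_mult_iff)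
    ultimately show ?thesis
      using prime_imp_coprime by (metis coprime_iff_gcd_eq_1)
  qed
  ultimately have w2: "w ^ 2 = w"
    by (simp add: GF_def)
  then have "w ^ 4 = w" "w ^ 8 = w" "w ^ 16 = w"
    using power_mult [of w 2 2] power_mult [of w 2 4] power_mult [of w 2 8] by simp_all
  \<comment> \<open>All five terms equal \<open>w\<close>, and 5 is odd.\<close>
  with w2 show ?thesis
    using assms(3) by (simp add: char_2_simps CHAR_bit)
qed

text \<open>
  Two points with the same value have the same trace \<open>t\<close>. With \<open>t\<close> fixed, the remaining
  expression is additive in \<open>x\<close>, so it suffices to study its zeros \<open>d\<close>.
\<close>
lemma inj_on_reduced_map:
  assumes "even e" "\<not> 5 dvd e"
  shows "inj_on (reduced_map e) (GF (4 ^ e))"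
proof (rule inj_onI)
  fix x y :: "bit alg_closure"
  assume x: "x \<in> GF (4 ^ e)" and y: "y \<in> GF (4 ^ e)" and eq: "reduced_map e x = reduced_map e y"
  define t where "t = poly (S 4 e) x"
  have ty: "poly (S 4 e) y = t"
    using poly_S_reduced_map [OF x assms(1)] poly_S_reduced_map [OF y assms(1)] eq by (simp add: t_def)
  have t: "t \<in> GF 4"
    using poly_S_in_GF_4 [OF x] by (simp add: t_def)
  \<comment> \<open>The difference of \<open>x\<close> and \<open>y\<close>, as the characteristic is two.\<close>
  define d where "d = x + y"
  have d_pow: "d ^ (2 ^ m) = x ^ (2 ^ m) + y ^ (2 ^ m)" for m
    unfolding d_def by (rule power_add_char_2)
  have d4: "d ^ 4 = x ^ 4 + y ^ 4" and d16: "d ^ 16 = x ^ 16 + y ^ 16"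
    and d64: "d ^ 64 = x ^ 64 + y ^ 64"
    using d_pow [of 2] d_pow [of 4] d_pow [of 6] by simp_all
  have "d ^ 64 + (d + d ^ 4) ^ 2 * t ^ 2 + (d + d ^ 4 + d ^ 16 + d ^ 64) * t ^ 3
      = reduced_map e x + reduced_map e y"
    unfolding reduced_map_def ty t_def [symmetric] d4 d16 d64 unfolding d_def
    by (simp add: power_add_char_2 [where m = 1, simplified] algebra_simps
        char_2_simps CHAR_bit)
  also have "\<dots> = 0"
    by (simp add: eq char_2_simps CHAR_bit)
  finally have d: "d ^ 64 + (d + d ^ 4) ^ 2 * t ^ 2 + (d + d ^ 4 + d ^ 16 + d ^ 64) * t ^ 3 = 0" .
  have "d = 0"
  proof (cases "t = 0")
    case True
    then show ?thesis
      using d by simp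
  next
    case False
    have t_pow: "t ^ 4 = t" "t ^ 16 = t" "t ^ 64 = t"
      using GF_power_subset [OF t, of 1] GF_power_subset [OF t, of 2] GF_power_subset [OF t, of 3]
      by (simp_all add: GF_def)
    then have t3: "t ^ 3 = 1"
      using False by (simp add: eval_nat_numeral)
    \<comment> \<open>After cancellation of \<open>d\<^sup>6\<^sup>4\<close> the equation is \<open>d + d\<^sup>4 + d\<^sup>1\<^sup>6 + t\<^sup>2 (d\<^sup>2 + d\<^sup>8) = 0\<close>. The scaling
      \<open>d = s w\<close> with \<open>s \<in> \<bbbF>\<^sub>4\<close> gives the two parts the factors \<open>s\<close> and \<open>t\<^sup>2 s\<^sup>2\<close>; these agree for
      \<open>s = t\<close>.\<close>
    define w where "w = d / t"
    have dw: "d = t * w"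
      using False by (simp add: w_def)
    have "d \<in> GF (4 ^ e)"
      using d_pow [of "2 * e"] x y by (simp add: GF_def power_mult d_def)
    then have "w \<in> GF (4 ^ e)"
      using GF_power_subset [OF t, of e] by (simp add: GF_def w_def power_divide)
    moreover have "t * (w + w ^ 2 + w ^ 4 + w ^ 8 + w ^ 16) = 0"
    proof -
      have "(t * w + t * w ^ 4) ^ 2 * t ^ 2 = t ^ 4 * (w + w ^ 4) ^ 2"
        by (simp add: algebra_simps eval_nat_numeral)
      also have "\<dots> = t * (w ^ 2 + w ^ 8)"
        by (simp add: t_pow power_add_char_2 [where m = 1, simplified] flip: power_mult)
      finally show ?thesis
        using d unfolding dw
        by (simp add: power_mult_distrib t_pow t3 distrib_left ac_simps char_2_simps CHAR_bit)
    qed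
    ultimately have "w = 0"
      using linearized_quintic_root_eq_0 [OF _ assms(2)] False by simp
    then show ?thesis
      by (simp add: dw)
  qed
  then show "x = y"
    by (metis d_def CHAR_bit CHAR_alg_closure add_right_cancel char_2_simps(1))
qed

lemma reduced_map_in_GF: "reduced_map e x \<in> GF (4 ^ e)" if "x \<in> GF (4 ^ e)" "e > 0"
  unfolding reduced_map_def
  by (intro GF_add [of 2 "4 ^ e" "2 * e"] GF_mult [of 2 "4 ^ e" "2 * e"] GF_power that
      GF_power_subset [OF poly_S_in_GF_4]) (use \<open>e > 0\<close> in \<open>simp_all add: CHAR_bit power_mult\<close>)

theorem proposition3p7:
  fixes q e n :: nat
  assumes "q = 4" and "e > 0"
    and "n = 1 + 2 * q ^ 2 + q ^ 4 + q ^ e + 2 * q ^ (e + 2)"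
  shows "[g_poly q n = pX ^ (q ^ 3) + S q e + S q 2 ^ 2 * S q e ^ 2 + S q 4 * S q e ^ 3]
           (mod (pX ^ (q ^ e) - pX :: bit poly))
       \<and> (2 dvd e \<and> \<not> 5 dvd e \<longrightarrow>
            permutation_polynomial (GF (q ^ e)) (map_poly to_ac (g_poly q n :: bit poly)))"
proof (intro conjI impI)
  let ?f = "pX ^ (4 ^ 3) + S 4 e + S 4 2 ^ 2 * S 4 e ^ 2 + S 4 4 * S 4 e ^ 3 :: bit poly"
  let ?g = "g_poly 4 n :: bit poly"
  have cong: "[?g = ?f] (mod (pX ^ (4 ^ e) - pX))"
    by (rule g_poly_cong) (use assms in simp)
  then show "[g_poly q n = pX ^ (q ^ 3) + S q e + S q 2 ^ 2 * S q e ^ 2 + S q 4 * S q e ^ 3]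
           (mod (pX ^ (q ^ e) - pX :: bit poly))"
    by (simp only: \<open>q = 4\<close>)
  assume e: "2 dvd e \<and> \<not> 5 dvd e"
  \<comment> \<open>The multiple of the modulus vanishes at every point of the field.\<close>
  obtain h where "?g - ?f = (pX ^ (4 ^ e) - pX) * h"
    using cong by (auto simp: cong_iff_dvd_diff)
  then have g: "?g = ?f + (pX ^ (4 ^ e) - pX) * h"
    by (metis add.commute diff_add_cancel)
  have eval: "poly (map_poly to_ac ?g) x = reduced_map e x" if "x \<in> GF (4 ^ e)" for x
  proof -
    have "poly (S 4 2) x = x + x ^ 4" "poly (S 4 4) x = x + x ^ 4 + x ^ 16 + x ^ 64"
      by (simp_all add: poly_S eval_nat_numeral)
    then show ?thesis
      unfolding g using that
      by (simp add: map_poly_to_ac_simps GF_def reduced_map_def)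
  qed
  have "inj_on (reduced_map e) (GF (4 ^ e))"
    using e by (intro inj_on_reduced_map) auto
  moreover have "reduced_map e ` GF (4 ^ e) \<subseteq> GF (4 ^ e)"
    using reduced_map_in_GF \<open>e > 0\<close> by auto
  moreover have "finite (GF (4 ^ e) :: bit alg_closure set)"
    by (rule card_ge_0_finite) (simp add: card_GF_4 \<open>e > 0\<close>)
  ultimately have "bij_betw (reduced_map e) (GF (4 ^ e)) (GF (4 ^ e))"
    by (simp add: bij_betw_def endo_inj_surj)
  then show "permutation_polynomial (GF (q ^ e)) (map_poly to_ac (g_poly q n :: bit poly))"
    by (simp add: permutation_polynomial_def \<open>q = 4\<close> eval cong: bij_betw_cong)
qed

end
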